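(* Let $H:D_1\to[0,1]$, $H(a,b)=h_{top}(f_{(a,b)})$. The set of $(a,b)\in D_1$ at which $H$ is locally constant (i.e. such that $H$ is constant on a neighbourhood of $(a,b)$ in $D_1$) is open and dense in $D_1$. Moreover, it has full Lebesgue measure in $D_1$.
   Context: $S^1$ is identified with $[0,1)$ (endpoints glued), and $f:S^1\to S^1$, $f(x)=2x \bmod 1$. For $a,b\in S^1$, $a\ne b$, $(a,b)$ is the open arc from $a$ to $b$ (anticlockwise), and $X_{(a,b)}=\{x\in S^1 : f^n(x)\notin(a,b)\text{ for every } n\ge 0\}$. For $a\in(\frac14,\frac12)$ put $\chi(a)=\sup\{b\in S^1 : X_{(a,b)}\text{ is uncountable}\}$, and $D_1=\{(a,b)\in(\frac14,\frac12)\times(\frac12,\frac34) : b\le\chi(a)\}$. The attractor is $\Lambda_{(a,b)}=[2b-1,2a]\cap X_{(a,b)}$. The number $h_{top}(f_{(a,b)})$ is the topological entropy (computed with logarithms to base $2$) of $f$ restricted to the attractor $\Lambda_{(a,b)}$. *)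

theory Defs
  imports "HOL-Analysis.Analysis"
begin

text \<open>The circle is \<open>{0..<1}\<close> with its endpoints glued, so its metric is \<open>circle_dist\<close>
  rather than the metric inherited from the reals.\<close>

definition circle :: "real set" where
  "circle = {0..<1}"

definition circle_dist :: "real \<Rightarrow> real \<Rightarrow> real" where
  "circle_dist x y = min (frac (x - y)) (frac (y - x))"

definition doubling :: "real \<Rightarrow> real" where
  "doubling x = frac (2 * x)"

text \<open>The anticlockwise open arc from \<open>a\<close> to \<open>b\<close>, for distinct \<open>a\<close>, \<open>b\<close> in the circle; it passes
  through \<open>0\<close> when \<open>b < a\<close> (unless \<open>b = 0\<close>).\<close>

definition arc_between :: "real \<Rightarrow> real \<Rightarrow> real set" where
  "arc_between a b = (if a < b then {a<..<b} else {a<..<1} \<union> {0..<b})"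

definition avoiding_set :: "real \<Rightarrow> real \<Rightarrow> real set" where
  "avoiding_set a b = {x \<in> circle. \<forall>n. (doubling ^^ n) x \<notin> arc_between a b}"

definition chi :: "real \<Rightarrow> real" where
  "chi a = Sup {b \<in> circle. b \<noteq> a \<and> uncountable (avoiding_set a b)}"

definition D1 :: "(real \<times> real) set" where
  "D1 = {(a, b). a \<in> {1/4<..<1/2} \<and> b \<in> {1/2<..<3/4} \<and> b \<le> chi a}"

definition attractor :: "real \<Rightarrow> real \<Rightarrow> real set" where
  "attractor a b = {2 * b - 1..2 * a} \<inter> avoiding_set a b"

text \<open>Topological entropy (Bowen's definition by separated sets, logarithms to base 2) of \<open>T\<close>
  restricted to a \<open>T\<close>-invariant set \<open>K\<close> that is compact for the metric \<open>d\<close>. The supremum of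
  \<open>log 2 (card E)\<close> over the separated sets \<open>E\<close> is the logarithm of their maximal cardinality;
  empty \<open>E\<close> is excluded because \<open>log 2 0 = 0\<close> in HOL. The growth rate is antitone in
  \<open>\<epsilon>\<close>, so its limit for \<open>\<epsilon>\<close> tending to \<open>0\<close> is the supremum over \<open>\<epsilon> > 0\<close>.\<close>

definition separated_set ::
    "('a \<Rightarrow> 'a \<Rightarrow> real) \<Rightarrow> ('a \<Rightarrow> 'a) \<Rightarrow> nat \<Rightarrow> real \<Rightarrow> 'a set \<Rightarrow> bool" where
  "separated_set d T n \<epsilon> E \<longleftrightarrow>
     (\<forall>x\<in>E. \<forall>y\<in>E. x \<noteq> y \<longrightarrow> (\<exists>k<n. d ((T ^^ k) x) ((T ^^ k) y) > \<epsilon>))"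

definition separated_growth ::
    "('a \<Rightarrow> 'a \<Rightarrow> real) \<Rightarrow> ('a \<Rightarrow> 'a) \<Rightarrow> 'a set \<Rightarrow> real \<Rightarrow> ereal" where
  "separated_growth d T K \<epsilon> =
     limsup (\<lambda>n. SUP E \<in> {E. E \<subseteq> K \<and> finite E \<and> E \<noteq> {} \<and> separated_set d T n \<epsilon> E}.
       ereal (log 2 (real (card E)) / real n))"

definition top_entropy ::
    "('a \<Rightarrow> 'a \<Rightarrow> real) \<Rightarrow> ('a \<Rightarrow> 'a) \<Rightarrow> 'a set \<Rightarrow> ereal" where
  "top_entropy d T K = (SUP \<epsilon> \<in> {0<..}. separated_growth d T K \<epsilon>)"

definition H :: "real \<times> real \<Rightarrow> ereal" where
  "H = (\<lambda>(a, b). top_entropy circle_dist doubling (attractor a b))"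

definition locally_constant_at ::
    "('a::topological_space) set \<Rightarrow> ('a \<Rightarrow> 'b) \<Rightarrow> 'a \<Rightarrow> bool" where
  "locally_constant_at D g p \<longleftrightarrow>
     (\<exists>U. openin (top_of_set D) U \<and> p \<in> U \<and> (\<forall>q\<in>U. g q = g p))"

lemma circle_dist_eq:
  assumes "x \<in> circle" "y \<in> circle"
  shows "circle_dist x y = min \<bar>x - y\<bar> (1 - \<bar>x - y\<bar>)"
proof -
  have *: "frac (u - v) = (if v \<le> u then u - v else u - v + 1)"
    if "u \<in> circle" "v \<in> circle" for u v
    using that by (subst frac_unique_iff) (auto simp: circle_def)
  show ?thesis using assms by (auto simp: circle_dist_def * circle_def)
qed

lemma circle_dist_metric: "Metric_space circle circle_dist"
proof
  show "0 \<le> circle_dist x y" for x y by (simp add: circle_dist_def)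
  show "circle_dist x y = circle_dist y x" for x y by (simp add: circle_dist_def min.commute)
  show "circle_dist x y = 0 \<longleftrightarrow> x = y" if "x \<in> circle" "y \<in> circle" for x y
    using that by (auto simp: circle_dist_eq) (auto simp: circle_def min_def abs_if split: if_splits)
  show "circle_dist x z \<le> circle_dist x y + circle_dist y z"
    if "x \<in> circle" "y \<in> circle" "z \<in> circle" for x y z
    using that by (simp add: circle_dist_eq) (simp add: circle_def min_def abs_if split: if_splits)
qed

lemma doubling_attractor_subset:
  assumes "a \<in> {1/4<..<1/2}" "b \<in> {1/2<..<3/4}"
  shows "doubling ` attractor a b \<subseteq> attractor a b"
proof (rule image_subsetI)
  fix x assume x: "x \<in> attractor a b"
  have orb: "(doubling ^^ n) (doubling x) \<notin> arc_between a b" for n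
  proof -
    have "(doubling ^^ Suc n) x \<notin> arc_between a b"
      using x unfolding attractor_def avoiding_set_def by blast
    then show ?thesis by (simp add: funpow_swap1)
  qed
  have hole: "x \<notin> {a<..<b}"
    using x assms by (auto simp: attractor_def avoiding_set_def arc_between_def dest: spec[of _ 0])
  have "doubling x \<in> {2 * b - 1..2 * a}"
  proof (cases "x \<le> a")
    case True
    then have "doubling x = 2 * x"
      using x assms by (simp add: doubling_def frac_eq attractor_def)
    then show ?thesis using x assms True by (auto simp: attractor_def)
  next
    case False
    then have "b \<le> x" using hole by auto
    then have "doubling x = 2 * x - 1"
      using x assms by (subst doubling_def, subst frac_unique_iff) (auto simp: attractor_def)
    then show ?thesis using x assms \<open>b \<le> x\<close> by (auto simp: attractor_def)
  qed
  moreover have "doubling x \<in> circle" by (simp add: doubling_def circle_def frac_lt_1)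
  ultimately show "doubling x \<in> attractor a b"
    using orb by (auto simp: attractor_def avoiding_set_def)
qed

end

theory Submission
  imports Defs
begin

text \<open>If the orbits of both endpoints enter the open hole \<open>(a, b)\<close>, then a small change of the
  endpoints changes neither the avoiding set nor the attractor, as every orbit through the altered
  part of the hole follows the orbit of an endpoint into the unaltered part. Almost every point of
  the circle has an orbit entering every neighbourhood of \<open>1/2\<close>, so by Fubini this covers almost
  every \<open>(a, b)\<close>. Density follows since, \<open>chi\<close> being increasing, \<open>D1\<close> contains a small
  rectangle with corner at any of its points.\<close>

section \<open>Orbits of doubling as fractional parts\<close>

lemma frac_of_int_mult_frac:
  fixes x :: "'a :: floor_ceiling"
  shows "frac (of_int m * frac x) = frac (of_int m * x)"
proof -
  have "of_int m * x = of_int m * frac x + of_int (m * \<lfloor>x\<rfloor>)"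
    by (simp add: frac_def algebra_simps)
  then show ?thesis by (simp only: frac_add_of_int_right)
qed

lemma frac_power2_mult_frac: "frac (2 ^ n * frac x) = frac (2 ^ n * x)" for x :: real
  using frac_of_int_mult_frac[of "2 ^ n" x] by simp

lemma frac_power2_comp: "frac (2 ^ n * frac (2 ^ m * x)) = frac (2 ^ (n + m) * x)" for x :: real
  by (simp add: frac_power2_mult_frac power_add mult.assoc)

lemma funpow_doubling: "x \<in> circle \<Longrightarrow> (doubling ^^ n) x = frac (2 ^ n * x)"
proof (induction n)
  case 0
  then show ?case by (simp add: circle_def)
next
  case (Suc n)
  then show ?case
    using frac_power2_comp[of 1 n x] by (simp add: doubling_def)
qed

lemma avoiding_set_eq:
  "a < b \<Longrightarrow> avoiding_set a b = {x \<in> circle. \<forall>n. frac (2 ^ n * x) \<notin> {a<..<b}}"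
  by (auto simp: avoiding_set_def arc_between_def funpow_doubling)

lemma avoiding_set_frac:
  assumes "a < b" "x \<in> avoiding_set a b"
  shows "frac (2 ^ n * x) \<in> avoiding_set a b"
  using assms by (auto simp: avoiding_set_eq circle_def frac_lt_1 frac_power2_comp)

lemma avoiding_set_mono:
  assumes "a < b" "a \<le> a'" "b' \<le> b" "a' < b'"
  shows "avoiding_set a b \<subseteq> avoiding_set a' b'"
proof -
  have "{a'<..<b'} \<subseteq> {a<..<b}"
    using assms by auto
  then show ?thesis
    using assms by (auto simp: avoiding_set_eq)
qed

text \<open>A fractional part above \<open>c\<close> is positive, so \<open>2 ^ n * x\<close> is not
  an integer, and \<open>frac\<close> jumps only at integers.\<close>

lemma isCont_frac_power2:
  fixes x :: real
  assumes "0 \<le> c" "c < frac (2 ^ n * x)"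
  shows "isCont (\<lambda>x. frac (2 ^ n * x)) x"
proof -
  have "2 ^ n * x \<notin> \<int>"
    using assms by (metis frac_gt_0_iff le_less_trans)
  then have "isCont frac (2 ^ n * x)"
    by (rule continuous_frac)
  then show ?thesis
    by (rule isCont_o2[rotated]) (intro continuous_intros)
qed

subsection \<open>Bounds on the entropy\<close>

text \<open>One of \<open>x - y\<close> and \<open>y - x\<close> is nonnegative, and its fractional
  part is at most itself.\<close>

lemma circle_dist_frac_le: "circle_dist (frac x) (frac y) \<le> \<bar>x - y\<bar>"
proof -
  have frac_le: "frac u \<le> u" if "0 \<le> u" for u :: real
    using that by (simp add: frac_def)
  have "frac (frac x - frac y) = frac (x - y)" for x y :: real
    by (metis frac_diff_simp frac_neg_eq_iff frac_neg_frac minus_diff_eq)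
  then show ?thesis
    using frac_le[of "x - y"] frac_le[of "y - x"]
    by (auto simp: circle_dist_def min_def abs_if)
qed

text \<open>Pigeonhole: \<open>k\<close> doublings stretch distances by at most
  \<open>2 ^ k\<close>, so two points in one cell of length \<open>\<epsilon> / 2 ^ n\<close> stay
  within \<open>\<epsilon>\<close> for \<open>n\<close> steps. A separated set thus has at most one
  point in each cell.\<close>

lemma card_separated_set_le:
  assumes "E \<subseteq> circle" "\<epsilon> > 0" "finite E" "separated_set circle_dist doubling n \<epsilon> E"
  shows "real (card E) \<le> (1 / \<epsilon> + 1) * 2 ^ n"
proof -
  \<comment> \<open>\<open>g x\<close> is the index of the cell of length
    \<open>\<epsilon> / 2 ^ n\<close> that contains \<open>x\<close>.\<close>
  define g where "g x = nat \<lfloor>x * 2 ^ n / \<epsilon>\<rfloor>" for x :: real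
  have pos: "0 \<le> x * 2 ^ n / \<epsilon>" if "x \<in> E" for x
    using that assms by (auto simp: circle_def)
  have "inj_on g E"
  proof (rule inj_onI, rule ccontr)
    fix x y assume xy: "x \<in> E" "y \<in> E" "g x = g y" "x \<noteq> y"
    have "\<lfloor>x * 2 ^ n / \<epsilon>\<rfloor> = \<lfloor>y * 2 ^ n / \<epsilon>\<rfloor>"
      using xy pos[of x] pos[of y] by (simp add: g_def eq_nat_nat_iff)
    then have "\<bar>x * 2 ^ n / \<epsilon> - y * 2 ^ n / \<epsilon>\<bar> < 1"
      by linarith
    moreover have "\<bar>x * 2 ^ n / \<epsilon> - y * 2 ^ n / \<epsilon>\<bar> = 2 ^ n * \<bar>x - y\<bar> / \<epsilon>"
      using \<open>\<epsilon> > 0\<close> by (simp add: abs_mult diff_divide_distrib[symmetric] left_diff_distrib[symmetric] mult.commute)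
    ultimately have close: "2 ^ n * \<bar>x - y\<bar> < \<epsilon>"
      using \<open>\<epsilon> > 0\<close> by simp
    obtain k where k: "k < n" "circle_dist ((doubling ^^ k) x) ((doubling ^^ k) y) > \<epsilon>"
      using assms(4) xy unfolding separated_set_def by blast
    have "circle_dist ((doubling ^^ k) x) ((doubling ^^ k) y) \<le> \<bar>2 ^ k * x - 2 ^ k * y\<bar>"
      using xy(1,2)[THEN subsetD[OF assms(1)]] by (simp add: funpow_doubling circle_dist_frac_le)
    also have "\<dots> = 2 ^ k * \<bar>x - y\<bar>"
      by (simp add: abs_mult right_diff_distrib[symmetric])
    also have "\<dots> \<le> 2 ^ n * \<bar>x - y\<bar>"
      using k by (intro mult_right_mono power_increasing) auto
    finally show False using close k by simp
  qed
  moreover have "g ` E \<subseteq> {..nat \<lfloor>2 ^ n / \<epsilon>\<rfloor>}"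
  proof
    fix z assume "z \<in> g ` E"
    then obtain x where x: "x \<in> E" "z = g x" by auto
    then have "x * 2 ^ n / \<epsilon> \<le> 2 ^ n / \<epsilon>"
      using assms by (intro divide_right_mono) (auto simp: circle_def)
    then show "z \<in> {..nat \<lfloor>2 ^ n / \<epsilon>\<rfloor>}"
      using x by (auto simp: g_def intro!: nat_mono floor_mono)
  qed
  ultimately have "card E \<le> card {..nat \<lfloor>2 ^ n / \<epsilon>\<rfloor>}"
    by (intro card_inj_on_le) auto
  then have "real (card E) \<le> real (nat \<lfloor>2 ^ n / \<epsilon>\<rfloor>) + 1"
    by simp
  \<comment> \<open>Bounding the extra cell by \<open>2 ^ n\<close> gives a constant times
    \<open>2 ^ n\<close>, which is what the growth rate requires.\<close>
  also have "\<dots> \<le> 2 ^ n / \<epsilon> + 2 ^ n"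
    using \<open>\<epsilon> > 0\<close> by (intro add_mono) auto
  finally show ?thesis by (simp add: distrib_right)
qed

text \<open>In the counting bound the factor depending on \<open>\<epsilon>\<close> contributes
  \<open>log 2 C / n\<close>, which tends to \<open>0\<close>; the factor \<open>2 ^ n\<close>
  contributes \<open>1\<close>.\<close>

lemma top_entropy_doubling_le_1:
  assumes "K \<subseteq> circle"
  shows "top_entropy circle_dist doubling K \<le> 1"
  unfolding top_entropy_def
proof (rule SUP_least)
  fix \<epsilon> :: real assume "\<epsilon> \<in> {0<..}"
  then have eps: "\<epsilon> > 0" by simp
  define C where "C = 1 / \<epsilon> + 1"
  have C: "C > 0" using eps by (simp add: C_def add_pos_pos)
  have le: "log 2 (real (card E)) / real n \<le> log 2 C / real n + 1"
    if E: "E \<subseteq> K" "finite E" "E \<noteq> {}" "separated_set circle_dist doubling n \<epsilon> E" and n: "n > 0"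
    for E n
  proof -
    have "real (card E) \<le> C * 2 ^ n"
      using card_separated_set_le[of E \<epsilon> n] E assms eps by (auto simp: C_def)
    then have "log 2 (real (card E)) \<le> log 2 (C * 2 ^ n)"
      using E C by (subst log_le_cancel_iff) (auto simp: card_gt_0_iff)
    also have "\<dots> = log 2 C + real n"
      using C by (simp add: log_mult log_nat_power)
    finally show ?thesis
      using n by (simp add: field_simps)
  qed
  have "separated_growth circle_dist doubling K \<epsilon>
      \<le> limsup (\<lambda>n. ereal (log 2 C / real n + 1))"
    unfolding separated_growth_def
    by (intro Limsup_mono eventually_mono[OF eventually_gt_at_top[of 0]] SUP_least)
       (auto intro!: le simp del: ereal_less_eq simp add: ereal_less_eq(3))
  also have "(\<lambda>n. log 2 C / real n + 1) \<longlonglongrightarrow> 0 + 1"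
    by (intro tendsto_intros lim_const_over_n)
  then have "limsup (\<lambda>n. ereal (log 2 C / real n + 1)) = 1"
    by (intro lim_imp_Limsup) (auto simp: one_ereal_def)
  finally show "separated_growth circle_dist doubling K \<epsilon> \<le> 1" .
qed

text \<open>A singleton is separated at every scale and contributes \<open>log 2 1 = 0\<close>. For
  empty \<open>K\<close> the suprema would run over no sets and give minus infinity, which is why
  attractors over \<open>D1\<close> are shown to be nonempty below.\<close>

lemma top_entropy_nonneg:
  assumes "K \<noteq> {}"
  shows "0 \<le> top_entropy d T K"
proof -
  obtain x where x: "x \<in> K" using assms by auto
  have "0 \<le> (SUP E \<in> {E. E \<subseteq> K \<and> finite E \<and> E \<noteq> {} \<and> separated_set d T n 1 E}.
       ereal (log 2 (real (card E)) / real n))" for n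
    using x by (intro SUP_upper2[of "{x}"]) (auto simp: separated_set_def)
  then have "0 \<le> liminf (\<lambda>n. SUP E \<in> {E. E \<subseteq> K \<and> finite E \<and> E \<noteq> {} \<and> separated_set d T n 1 E}.
       ereal (log 2 (real (card E)) / real n))"
    by (intro Liminf_bounded) auto
  also have "\<dots> \<le> separated_growth d T K 1"
    unfolding separated_growth_def by (intro Liminf_le_Limsup) auto
  also have "\<dots> \<le> top_entropy d T K"
    unfolding top_entropy_def by (intro SUP_upper) auto
  finally show ?thesis .
qed

subsection \<open>The region \<open>D1\<close>\<close>

text \<open>The number whose base-4 digits are the indicator of \<open>S\<close>; its binary
  expansion consists of the blocks 00 and 01.\<close>

definition cantor_num :: "nat set \<Rightarrow> real" where
  "cantor_num S = (\<Sum>n. indicator S n / 4 ^ (n + 1))"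

lemma sums_quarter_powers: "(\<lambda>n. 1 / 4 ^ (n + 1) :: real) sums (1 / 3)"
  using sums_mult[OF geometric_sums[of "1 / 4 :: real"], of "1 / 4"]
  by (simp add: power_divide)

lemma summable_cantor_num: "summable (\<lambda>n. indicator S n / 4 ^ (n + 1) :: real)"
  by (rule summable_comparison_test[OF _ sums_summable[OF sums_quarter_powers]])
     (auto intro!: divide_right_mono simp: indicator_def)

lemma cantor_num_bounds: "cantor_num S \<in> {0..1 / 3}"
proof -
  have "cantor_num S \<le> (\<Sum>n. 1 / 4 ^ (n + 1))"
    unfolding cantor_num_def
    by (intro suminf_le summable_cantor_num sums_summable[OF sums_quarter_powers])
       (auto simp: indicator_def)
  then show ?thesis
    using sums_unique[OF sums_quarter_powers]
    by (auto simp: cantor_num_def intro!: suminf_nonneg summable_cantor_num[simplified])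
qed

lemma cantor_num_rec: "cantor_num S = (indicator S 0 + cantor_num {n. Suc n \<in> S}) / 4"
proof -
  have "cantor_num S = indicator S 0 / 4 + (\<Sum>n. indicator S (Suc n) / 4 ^ (Suc n + 1))"
    using suminf_split_head[OF summable_cantor_num[of S]] by (simp add: cantor_num_def)
  also have "(\<Sum>n. indicator S (Suc n) / 4 ^ (Suc n + 1)) = cantor_num {n. Suc n \<in> S} / 4"
    unfolding cantor_num_def
    by (subst suminf_divide[OF summable_cantor_num, symmetric])
       (simp add: indicator_def mult.commute)
  finally show ?thesis by simp
qed

text \<open>The tail is at most \<open>1 / 3\<close>, so the leading digit decides on which side of
  the gap between \<open>1 / 12\<close> and \<open>1 / 4\<close> the number lies.\<close>

lemma cantor_num_cases:
  obtains "0 \<notin> S" "cantor_num S \<in> {0..1 / 12}" "cantor_num S = cantor_num {n. Suc n \<in> S} / 4"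
  | "0 \<in> S" "cantor_num S \<in> {1 / 4..1 / 3}" "cantor_num S = (1 + cantor_num {n. Suc n \<in> S}) / 4"
  using cantor_num_rec[of S] cantor_num_bounds[of "{n. Suc n \<in> S}"]
  by (cases "0 \<in> S") auto

text \<open>The gap reveals the leading digit; removing it reduces digit \<open>Suc n\<close> to
  digit \<open>n\<close> of the shifted sets.\<close>

lemma inj_cantor_num: "inj cantor_num"
proof (rule injI)
  have "n \<in> S \<longleftrightarrow> n \<in> T" if "cantor_num S = cantor_num T" for n S T
    using that
  proof (induction n arbitrary: S T)
    case 0
    then show ?case
      by (cases S rule: cantor_num_cases; cases T rule: cantor_num_cases) auto
  next
    case (Suc n)
    have "cantor_num {n. Suc n \<in> S} = cantor_num {n. Suc n \<in> T}"
      using Suc.prems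
      by (cases S rule: cantor_num_cases; cases T rule: cantor_num_cases) auto
    then show ?case using Suc.IH by blast
  qed
  then show "S = T" if "cantor_num S = cantor_num T" for S T
    using that by blast
qed

text \<open>Multiplication by 4 shifts the digits, up to an integer that \<open>frac\<close>
  discards. So modulo 1 the multiples by \<open>c\<close> form a set invariant under two
  doublings.\<close>

lemma frac_power4_cantor_num:
  "\<exists>T. frac (4 ^ k * (of_nat c * cantor_num S)) = frac (of_nat c * cantor_num T)"
proof (induction k arbitrary: S)
  case 0
  then show ?case by auto
next
  case (Suc k)
  let ?S = "{n. Suc n \<in> S}"
  have "4 ^ Suc k * (of_nat c * cantor_num S)
      = 4 ^ k * (of_nat c * cantor_num ?S) + of_int (4 ^ k * (int c * indicator S 0))"
    by (subst cantor_num_rec) (simp add: algebra_simps indicator_def)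
  then show ?case
    using Suc.IH[of ?S] by (simp only: frac_add_of_int_right)
qed

lemma uncountable_UNIV_nat_set: "uncountable (UNIV :: nat set set)"
proof
  assume "countable (UNIV :: nat set set)"
  then have "range (from_nat_into UNIV) = (UNIV :: nat set set)"
    by (intro range_from_nat_into) auto
  then show False
    using Cantors_theorem[of "UNIV :: nat set"] by auto
qed

text \<open>By this invariance every even time looks like time 0 and every odd time like time 1, so
  only these two have to be checked against the hole.\<close>

lemma uncountable_avoiding_cantor_num:
  assumes "c \<le> 3" "0 < c" "a < b"
    and avoid: "\<And>T. frac (of_nat c * cantor_num T) \<notin> {a<..<b}"
      "\<And>T. frac (2 * (of_nat c * cantor_num T)) \<notin> {a<..<b}"
  shows "uncountable (avoiding_set a b)"
proof
  define g where "g T = of_nat c * (cantor_num (Suc ` T))" for T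
  have g: "g T = of_nat c * cantor_num T / 4" for T
    using cantor_num_rec[of "Suc ` T"] by (simp add: g_def image_iff)
  have "inj g"
    using inj_cantor_num \<open>0 < c\<close> by (auto simp: g inj_def)
  have "range g \<subseteq> avoiding_set a b"
  proof
    fix x assume "x \<in> range g"
    then obtain T where x: "x = g T" by auto
    have "real c * cantor_num T \<le> 3 * (1 / 3)" "0 \<le> real c * cantor_num T"
      using cantor_num_bounds[of T] assms mult_mono[of "real c" 3 "cantor_num T" "1/3"] by auto
    then have "x \<in> circle"
      by (simp add: x g circle_def)
    moreover have "frac (2 ^ n * x) \<notin> {a<..<b}" for n
    proof -
      obtain T' where T': "frac (4 ^ (n div 2) * x) = frac (of_nat c * cantor_num T')"
        using frac_power4_cantor_num[of "n div 2" c "Suc ` T"] by (auto simp: x g_def)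
      have "frac (2 ^ n * x) = frac (2 ^ (n mod 2) * frac (4 ^ (n div 2) * x))"
        using frac_power2_comp[of "n mod 2" "2 * (n div 2)" x] by (simp add: power_mult)
      also have "\<dots> = frac (2 ^ (n mod 2) * (of_nat c * cantor_num T'))"
        unfolding T' by (rule frac_power2_mult_frac)
      finally show ?thesis
        using avoid[of T'] by (cases "even n") (auto simp: even_iff_mod_2_eq_zero odd_iff_mod_2_eq_one)
    qed
    ultimately show "x \<in> avoiding_set a b"
      using \<open>a < b\<close> by (simp add: avoiding_set_eq)
  qed
  moreover assume "countable (avoiding_set a b)"
  ultimately have "countable (range g)"
    by (rule countable_subset)
  then show False
    using \<open>inj g\<close> uncountable_UNIV_nat_set by (simp add: countable_image_inj_eq)
qed

lemma frac_1_diff: "x \<in> {1..<2} \<Longrightarrow> frac x = x - 1" for x :: real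
  by (auto simp: frac_unique_iff)

text \<open>This ensures that the supremum defining \<open>chi a\<close> is not one over the empty set. Multiplied by
  \<open>c = 1\<close>, the Cantor numbers have binary expansions avoiding the word 011; by \<open>c = 3\<close>, the word
  010.\<close>

lemma uncountable_avoiding_ex:
  assumes "a \<in> {1/4<..<1/2}"
  shows "\<exists>b\<in>{a<..1/2}. uncountable (avoiding_set a b)"
proof (cases "a < 3/8")
  case True
  \<comment> \<open>The intervals contain all values of \<open>3 * cantor_num T\<close> and
    \<open>6 * cantor_num T\<close>; modulo 1 they miss the open interval from \<open>1/4\<close> to
    \<open>3/8\<close>.\<close>
  have frac: "frac x \<notin> {a<..<3/8}"
    if "x \<in> {0..1/4} \<union> {3/8..5/8} \<union> {3/4..1} \<union> {3/2..13/8} \<union> {15/8..2}" for x :: real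
  proof (cases "x = 1 \<or> x = 2")
    case True
    then have "frac x = 0" by auto
    show ?thesis unfolding \<open>frac x = 0\<close> using assms by auto
  next
    case False
    then show ?thesis
      using that assms frac_1_diff[of x] frac_eq[of x] by (cases "x < 1") auto
  qed
  have "uncountable (avoiding_set a (3/8))"
  proof (rule uncountable_avoiding_cantor_num[of 3])
    fix T
    show "frac (of_nat 3 * cantor_num T) \<notin> {a<..<3/8}"
      by (intro frac, cases T rule: cantor_num_cases) auto
    show "frac (2 * (of_nat 3 * cantor_num T)) \<notin> {a<..<3/8}"
    proof (rule frac)
      \<comment> \<open>Two leading digits are examined, since a single digit 0 only places
        \<open>6 * cantor_num T\<close> in \<open>{0..1/2}\<close>, which meets the hole.\<close>
      have "cantor_num {n. Suc n \<in> T} \<in> {0..1 / 12} \<union> {1 / 4..1 / 3}"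
        by (cases "{n. Suc n \<in> T}" rule: cantor_num_cases) auto
      then show "2 * (of_nat 3 * cantor_num T)
          \<in> {0..1/4} \<union> {3/8..5/8} \<union> {3/4..1} \<union> {3/2..13/8} \<union> {15/8..2}"
        by (cases T rule: cantor_num_cases) auto
    qed
  qed (use True in auto)
  then show ?thesis using True assms by (intro bexI[of _ "3/8"]) auto
next
  case False
  \<comment> \<open>Here \<open>a \<ge> 3/8\<close> exceeds \<open>1/3\<close>, the largest Cantor
    number, while doubled Cantor numbers are at most \<open>1/6\<close> or at least
    \<open>1/2\<close>.\<close>
  have frac: "frac x \<notin> {a<..<1/2}" if "x \<in> {0..1/3} \<union> {1/2..2/3}" for x :: real
    using that False frac_eq[of x] by auto
  have "uncountable (avoiding_set a (1/2))"
  proof (rule uncountable_avoiding_cantor_num[of 1])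
    fix T
    show "frac (of_nat 1 * cantor_num T) \<notin> {a<..<1/2}"
      by (intro frac, cases T rule: cantor_num_cases) auto
    show "frac (2 * (of_nat 1 * cantor_num T)) \<notin> {a<..<1/2}"
      by (intro frac, cases T rule: cantor_num_cases) auto
  qed (use assms in auto)
  then show ?thesis using assms by (intro bexI[of _ "1/2"]) auto
qed

section \<open>Monotonicity of \<open>D1\<close> and nonempty attractors\<close>

lemma bdd_above_chi_set: "bdd_above {b \<in> circle. b \<noteq> a \<and> uncountable (avoiding_set a b)}"
  by (intro bdd_aboveI[of _ 1]) (auto simp: circle_def)

text \<open>Some \<open>b'\<close> beyond \<open>c\<close> has an uncountable avoiding set, and
  shrinking the hole back to \<open>c\<close> only enlarges that set.\<close>

lemma less_chi_imp_uncountable: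
  assumes "a \<in> {1/4<..<1/2}" "a < c" "c < chi a"
  shows "uncountable (avoiding_set a c)"
proof -
  let ?S = "{b \<in> circle. b \<noteq> a \<and> uncountable (avoiding_set a b)}"
  obtain b where "b \<in> {a<..1/2}" "uncountable (avoiding_set a b)"
    using uncountable_avoiding_ex assms(1) by blast
  then have "b \<in> ?S" using assms(1) by (auto simp: circle_def)
  then obtain b' where "b' \<in> ?S" "c < b'"
    using assms(3) less_cSup_iff[of ?S c] bdd_above_chi_set[of a] unfolding chi_def by blast
  moreover have "avoiding_set a b' \<subseteq> avoiding_set a c"
    using \<open>c < b'\<close> assms by (intro avoiding_set_mono) auto
  ultimately show ?thesis
    using countable_subset by blast
qed

text \<open>Moving \<open>a\<close> right shrinks the hole and preserves uncountability, so
  \<open>chi\<close> can only grow. The comparison runs through all \<open>c < b\<close>, as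
  \<open>b \<le> chi a\<close> says nothing about uncountability at \<open>b\<close> itself.\<close>

lemma D1_mono:
  assumes "(a, b) \<in> D1" "a \<le> a'" "a' < 1/2" "1/2 < b'" "b' \<le> b"
  shows "(a', b') \<in> D1"
proof -
  have ab: "a \<in> {1/4<..<1/2}" "b \<in> {1/2<..<3/4}" "b \<le> chi a"
    using assms(1) by (auto simp: D1_def)
  have "b \<le> chi a'"
  proof (rule dense_le_bounded[of "1/2"])
    fix c assume c: "1/2 < c" "c < b"
    have "uncountable (avoiding_set a c)"
      using c ab by (intro less_chi_imp_uncountable) auto
    moreover have "avoiding_set a c \<subseteq> avoiding_set a' c"
      using c assms by (intro avoiding_set_mono) auto
    ultimately have "uncountable (avoiding_set a' c)"
      using countable_subset by blast
    then show "c \<le> chi a'"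
      unfolding chi_def using c ab assms
      by (intro cSup_upper bdd_above_chi_set) (auto simp: circle_def)
  qed (use ab in auto)
  then show ?thesis using assms ab by (auto simp: D1_def)
qed

text \<open>An irrational orbit avoiding the hole is pushed away from \<open>0\<close> by doubling and reaches the
  interval of the attractor from either side without jumping over it.\<close>

lemma attractor_nonempty_if_uncountable:
  assumes a: "a \<in> {1/4<..<1/2}" and c: "c \<in> {1/2<..<3/4}"
    and unc: "uncountable (avoiding_set a c)"
  shows "attractor a c \<noteq> {}"
proof
  assume empty: "attractor a c = {}"
  \<comment> \<open>Irrationality is used to exclude the fixed point \<open>0\<close>, which
    doubling does not push away.\<close>
  have "\<not> avoiding_set a c \<subseteq> \<rat>"
    using unc countable_rat countable_subset by blast
  then obtain x where x: "x \<in> avoiding_set a c" "x \<notin> \<rat>" by blast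
  have orb: "frac (2 ^ n * x) \<notin> {a<..<c}" "x \<in> {0..<1}" for n
    using x a c by (auto simp: avoiding_set_eq circle_def)
  have out: "frac (2 ^ n * x) \<notin> {2 * c - 1..2 * a}" for n
    using empty avoiding_set_frac[of a c x n] x a c by (auto simp: attractor_def)
  have "x \<noteq> 0" using x by auto
  with orb have pos: "0 < x" "x < 1" by auto
  have "x < 2 * c - 1 \<or> 2 * a < x"
    using out[of 0] orb(2) by auto
  then show False
  proof
    assume less: "x < 2 * c - 1"
    \<comment> \<open>A point below \<open>2 * c - 1\<close> is left of \<open>c\<close>, hence at
      most \<open>a\<close>. Its double is at most \<open>2 * a\<close>, so it does not wrap around,
      and missing the interval it is again below \<open>2 * c - 1\<close>.\<close>
    have bound: "2 ^ n * x < 2 * c - 1" for n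
    proof (induction n)
      case 0
      then show ?case using less by simp
    next
      case (Suc n)
      have "frac (2 ^ n * x) = 2 ^ n * x"
        using Suc c pos by (simp add: frac_eq)
      then have "2 ^ n * x \<le> a"
        using Suc orb(1)[of n] c by auto
      then have le: "2 ^ Suc n * x \<le> 2 * a" by simp
      then have "frac (2 ^ Suc n * x) = 2 ^ Suc n * x"
        using a pos by (subst frac_eq) auto
      then show ?case
        using out[of "Suc n"] le by auto
    qed
    obtain n where "1 / x < 2 ^ n"
      using real_arch_pow[of 2 "1 / x"] by auto
    then have "1 < 2 ^ n * x"
      using pos by (simp add: field_simps)
    then show False
      using bound[of n] c by auto
  next
    assume greater: "2 * a < x"
    \<comment> \<open>The mirror image: the distance to \<open>1\<close> doubles at each step, and
      \<open>z\<close> below is the representative of \<open>2 ^ n * x\<close> modulo 1 near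
      \<open>1\<close>.\<close>
    have bound: "2 ^ n * (1 - x) < 1 - 2 * a" for n
    proof (induction n)
      case 0
      then show ?case using greater by simp
    next
      case (Suc n)
      define z where "z = 1 - 2 ^ n * (1 - x)"
      have "2 ^ n * x - z = of_int (2 ^ n - 1)"
        by (simp add: z_def algebra_simps)
      then have "2 ^ n * x - z \<in> \<int>" by (metis Ints_of_int)
      moreover have z: "2 * a < z" "z < 1"
        using Suc pos by (auto simp: z_def)
      ultimately have "frac (2 ^ n * x) = z"
        using a by (simp add: frac_unique_iff)
      then have "c \<le> z"
        using z orb(1)[of n] a by auto
      moreover have "frac (2 ^ Suc n * x) = frac (2 * z)"
        using frac_power2_comp[of 1 n x] \<open>frac (2 ^ n * x) = z\<close> by simp
      ultimately have "frac (2 ^ Suc n * x) = 2 * z - 1"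
        using z c by (simp add: frac_1_diff)
      then have "2 * a < 2 * z - 1"
        using out[of "Suc n"] \<open>c \<le> z\<close> by auto
      then show ?case by (simp add: z_def)
    qed
    obtain n where "1 / (1 - x) < 2 ^ n"
      using real_arch_pow[of 2 "1 / (1 - x)"] by auto
    then have "1 < 2 ^ n * (1 - x)"
      using pos by (simp add: field_simps)
    then show False
      using bound[of n] a by auto
  qed
qed

text \<open>Uncountability is known only for holes ending before \<open>b\<close>. Points of the
  attractors of such holes, whose right ends tend to \<open>b\<close>, accumulate by compactness at
  a point of the attractor for \<open>b\<close>.\<close>

lemma attractor_nonempty:
  assumes "(a, b) \<in> D1"
  shows "attractor a b \<noteq> {}"
proof -
  have ab: "a \<in> {1/4<..<1/2}" "b \<in> {1/2<..<3/4}" "b \<le> chi a"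
    using assms by (auto simp: D1_def)
  \<comment> \<open>With \<open>n + 1\<close> as denominator the first term would be
    \<open>1/2\<close> itself, which is not allowed as a right end.\<close>
  define c where "c n = b - (b - 1/2) / real (n + 2)" for n
  have c: "1/2 < c n" "c n < b" for n
  proof -
    define e where "e = (b - 1/2) / real (n + 2)"
    have "e < (b - 1/2) / 1"
      unfolding e_def using ab by (intro divide_strict_left_mono) auto
    moreover have "c n = b - e" by (simp only: c_def e_def)
    moreover have "0 < e" using ab by (simp add: e_def)
    ultimately show "1/2 < c n" "c n < b" by auto
  qed
  have "attractor a (c n) \<noteq> {}" for n
    using c[of n] ab
    by (intro attractor_nonempty_if_uncountable less_chi_imp_uncountable) auto
  moreover define y where "y n = (SOME z. z \<in> attractor a (c n))" for n
  ultimately have y: "y n \<in> attractor a (c n)" for n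
    by (simp add: some_in_eq)
  have "y n \<in> {0..1}" for n
    using y[of n] by (auto simp: attractor_def avoiding_set_def circle_def)
  then obtain l r where l: "strict_mono r" "(y \<circ> r) \<longlonglongrightarrow> l"
    using seq_compactE[OF compact_imp_seq_compact[OF compact_Icc], of y 0 1] by blast
  have "(\<lambda>n. (b - 1/2) / real (n + 2)) \<longlonglongrightarrow> 0"
    using LIMSEQ_ignore_initial_segment[OF lim_const_over_n[of "b - 1/2"], of 2] by simp
  then have "c \<longlonglongrightarrow> b - 0"
    unfolding c_def by (intro tendsto_intros)
  then have cr: "(c \<circ> r) \<longlonglongrightarrow> b"
    using LIMSEQ_subseq_LIMSEQ[OF _ l(1)] by simp
  have "l \<le> 2 * a"
    by (rule LIMSEQ_le_const2[OF l(2)]) (use y in \<open>auto simp: attractor_def\<close>)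
  moreover have "2 * b - 1 \<le> l"
  proof (rule LIMSEQ_le[OF _ l(2)])
    show "(\<lambda>n. 2 * (c \<circ> r) n - 1) \<longlonglongrightarrow> 2 * b - 1"
      by (intro tendsto_intros cr)
  qed (use y in \<open>auto simp: attractor_def\<close>)
  moreover have "frac (2 ^ k * l) \<notin> {a<..<b}" for k
  proof
    assume hole: "frac (2 ^ k * l) \<in> {a<..<b}"
    \<comment> \<open>If the limit entered the hole at time \<open>k\<close>, continuity would bring
      \<open>y (r n)\<close> into its own hole for large \<open>n\<close>, as the right ends tend to
      \<open>b\<close>.\<close>
    have "isCont (\<lambda>x. frac (2 ^ k * x)) l"
      using hole ab by (intro isCont_frac_power2[of a]) auto
    from isCont_tendsto_compose[OF this l(2)]
    have lim: "(\<lambda>n. frac (2 ^ k * (y \<circ> r) n)) \<longlonglongrightarrow> frac (2 ^ k * l)" .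
    have "\<forall>\<^sub>F n in sequentially. 0 < (c \<circ> r) n - frac (2 ^ k * (y \<circ> r) n)"
      by (rule order_tendstoD(1)[OF tendsto_diff[OF cr lim]]) (use hole in auto)
    moreover have "\<forall>\<^sub>F n in sequentially. a < frac (2 ^ k * (y \<circ> r) n)"
      by (rule order_tendstoD(1)[OF lim]) (use hole in auto)
    ultimately have "\<forall>\<^sub>F n in sequentially. False"
    proof eventually_elim
      case (elim n)
      then show ?case
        using y[of "r n"] c[of "r n"] ab by (auto simp: attractor_def avoiding_set_eq)
    qed
    then show False by simp
  qed
  ultimately have "l \<in> attractor a b"
    using ab by (auto simp: attractor_def avoiding_set_eq circle_def)
  then show ?thesis by auto
qed

subsection \<open>Local constancy\<close>

text \<open>A visit to the added part of the new hole would be followed by a visit to the old one.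
  If the new endpoint lies inside the old hole, the hypothesis on that side is vacuous, so no case
  distinction on the direction of the change arises.\<close>

lemma attractor_subset:
  assumes "a \<in> {1/4<..<1/2}" "b \<in> {1/2<..<3/4}" "a' \<in> {1/4<..<1/2}" "b' \<in> {1/2<..<3/4}"
    and a: "\<And>t. a' < t \<Longrightarrow> t \<le> a \<Longrightarrow> frac (2 ^ n * t) \<in> {a<..<b}"
    and b: "\<And>t. b \<le> t \<Longrightarrow> t < b' \<Longrightarrow> frac (2 ^ m * t) \<in> {a<..<b}"
  shows "attractor a b \<subseteq> attractor a' b'"
proof
  fix x assume x: "x \<in> attractor a b"
  then have orb: "frac (2 ^ k * x) \<notin> {a<..<b}" and "x \<in> circle" for k
    using assms by (auto simp: attractor_def avoiding_set_eq)
  have orb': "frac (2 ^ k * x) \<notin> {a'<..<b'}" for k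
  proof
    assume "frac (2 ^ k * x) \<in> {a'<..<b'}"
    then consider "a' < frac (2 ^ k * x)" "frac (2 ^ k * x) \<le> a"
      | "b \<le> frac (2 ^ k * x)" "frac (2 ^ k * x) < b'"
      using orb[of k] by fastforce
    then show False
      using a[of "frac (2 ^ k * x)"] b[of "frac (2 ^ k * x)"] orb[of "n + k"] orb[of "m + k"]
      by cases (auto simp: frac_power2_comp)
  qed
  \<comment> \<open>Otherwise the preimage \<open>x / 2\<close> lies in the added part. Its visit to
    the hole is not at time 0, as \<open>x / 2 \<le> a\<close>, so it belongs to the orbit of
    \<open>x\<close>.\<close>
  have "x \<le> 2 * a'"
  proof (rule ccontr)
    assume "\<not> x \<le> 2 * a'"
    then have t: "a' < x / 2" "x / 2 \<le> a" using x by (auto simp: attractor_def)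
    have "frac (x / 2) = x / 2" using t assms by (simp add: frac_eq)
    then obtain k where "n = Suc k"
      using a[OF t] t by (cases n) auto
    then show False using a[OF t] orb[of k] by simp
  qed
  \<comment> \<open>The same argument with the other preimage of \<open>x\<close>, which lies near
    \<open>b\<close>.\<close>
  moreover have "2 * b' - 1 \<le> x"
  proof (rule ccontr)
    define t where "t = (x + 1) / 2"
    assume "\<not> 2 * b' - 1 \<le> x"
    then have t: "b \<le> t" "t < b'" using x by (auto simp: attractor_def t_def)
    have "frac t = t" using t assms by (simp add: frac_eq)
    then obtain k where m: "m = Suc k"
      using b[OF t] t by (cases m) auto
    have "2 ^ m * t = 2 ^ k * x + of_int (2 ^ k)"
      by (simp add: m t_def field_simps)
    then have "frac (2 ^ m * t) = frac (2 ^ k * x)"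
      by (simp only: frac_add_of_int_right)
    then show False using b[OF t] orb[of k] by simp
  qed
  ultimately show "x \<in> attractor a' b'"
    using orb' \<open>x \<in> circle\<close> assms by (auto simp: attractor_def avoiding_set_eq)
qed

lemma frac_power2_near:
  fixes c d x :: real
  assumes "frac (2 ^ n * x) \<in> {c<..<d}" "0 \<le> c"
  shows "\<exists>\<delta>>0. \<forall>t. \<bar>t - x\<bar> < \<delta> \<longrightarrow> frac (2 ^ n * t) \<in> {c<..<d}"
proof -
  have "isCont (\<lambda>x. frac (2 ^ n * x)) x"
    using assms by (intro isCont_frac_power2[of c]) auto
  then have "((\<lambda>x. frac (2 ^ n * x)) \<longlongrightarrow> frac (2 ^ n * x)) (nhds x)"
    by (simp add: continuous_at_imp_continuous_at_within isCont_def tendsto_nhds_iff)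
  then have "\<forall>\<^sub>F t in nhds x. frac (2 ^ n * t) \<in> {c<..<d}"
    by (rule topological_tendstoD) (use assms in auto)
  then show ?thesis
    by (auto simp: eventually_nhds_metric dist_real_def)
qed

text \<open>Both visits fall into some \<open>{c<..<d}\<close> well inside the hole. For nearby
  endpoints this interval still lies in the hole and still receives the visits, so the inclusion
  holds between any two nearby attractors.\<close>

lemma attractor_locally_constant:
  assumes ab: "a \<in> {1/4<..<1/2}" "b \<in> {1/2<..<3/4}"
    and "frac (2 ^ n * a) \<in> {a<..<b}" "frac (2 ^ m * b) \<in> {a<..<b}"
  shows "\<exists>\<delta>>0. \<forall>a'\<in>{1/4<..<1/2}. \<forall>b'\<in>{1/2<..<3/4}.
    \<bar>a' - a\<bar> < \<delta> \<longrightarrow> \<bar>b' - b\<bar> < \<delta> \<longrightarrow> attractor a' b' = attractor a b"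
proof -
  let ?p = "frac (2 ^ n * a)" and ?q = "frac (2 ^ m * b)"
  obtain c where c: "a < c" "c < min ?p ?q"
    using assms dense[of a "min ?p ?q"] by auto
  obtain d where d: "max ?p ?q < d" "d < b"
    using assms dense[of "max ?p ?q" b] by auto
  obtain \<delta>1 where \<delta>1: "\<delta>1 > 0" "\<bar>t - a\<bar> < \<delta>1 \<Longrightarrow> frac (2 ^ n * t) \<in> {c<..<d}" for t
    using frac_power2_near[of n a c d] c d ab by auto
  obtain \<delta>2 where \<delta>2: "\<delta>2 > 0" "\<bar>t - b\<bar> < \<delta>2 \<Longrightarrow> frac (2 ^ m * t) \<in> {c<..<d}" for t
    using frac_power2_near[of m b c d] c d ab by auto
  define \<delta> where "\<delta> = Min {\<delta>1, \<delta>2, c - a, b - d}"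
  have \<delta>: "\<delta> > 0" "\<delta> \<le> \<delta>1" "\<delta> \<le> \<delta>2" "\<delta> \<le> c - a" "\<delta> \<le> b - d"
    using \<delta>1(1) \<delta>2(1) c d by (auto simp: \<delta>_def)
  have sub: "attractor a1 b1 \<subseteq> attractor a2 b2"
    if "a1 \<in> {1/4<..<1/2}" "b1 \<in> {1/2<..<3/4}" "a2 \<in> {1/4<..<1/2}" "b2 \<in> {1/2<..<3/4}"
      and near: "\<bar>a1 - a\<bar> < \<delta>" "\<bar>b1 - b\<bar> < \<delta>" "\<bar>a2 - a\<bar> < \<delta>" "\<bar>b2 - b\<bar> < \<delta>"
    for a1 b1 a2 b2
  proof (rule attractor_subset[where n = n and m = m])
    have hole: "{c<..<d} \<subseteq> {a1<..<b1}" using near \<delta> by auto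
    show "frac (2 ^ n * t) \<in> {a1<..<b1}" if "a2 < t" "t \<le> a1" for t
    proof -
      have "\<bar>t - a\<bar> < \<delta>1" using that near \<delta> by linarith
      then show ?thesis using \<delta>1(2) hole by blast
    qed
    show "frac (2 ^ m * t) \<in> {a1<..<b1}" if "b1 \<le> t" "t < b2" for t
    proof -
      have "\<bar>t - b\<bar> < \<delta>2" using that near \<delta> by linarith
      then show ?thesis using \<delta>2(2) hole by blast
    qed
  qed fact+
  show ?thesis
    using \<delta>(1) ab by (intro exI[of _ \<delta>] conjI ballI impI subset_antisym sub) auto
qed

lemma locally_constant_at_H:
  assumes "(a, b) \<in> D1" "frac (2 ^ n * a) \<in> {a<..<b}" "frac (2 ^ m * b) \<in> {a<..<b}"
  shows "locally_constant_at D1 H (a, b)"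
proof -
  obtain \<delta> where \<delta>: "\<delta> > 0" "\<And>a' b'. a' \<in> {1/4<..<1/2} \<Longrightarrow> b' \<in> {1/2<..<3/4} \<Longrightarrow>
      \<bar>a' - a\<bar> < \<delta> \<Longrightarrow> \<bar>b' - b\<bar> < \<delta> \<Longrightarrow> attractor a' b' = attractor a b"
    using attractor_locally_constant[of a b n m] assms unfolding D1_def by blast
  show ?thesis
    unfolding locally_constant_at_def
  proof (intro exI conjI ballI)
    show "openin (top_of_set D1) (D1 \<inter> ({a - \<delta><..<a + \<delta>} \<times> {b - \<delta><..<b + \<delta>}))"
      by (intro openin_open_Int open_Times) auto
    show "(a, b) \<in> D1 \<inter> ({a - \<delta><..<a + \<delta>} \<times> {b - \<delta><..<b + \<delta>})"
      using assms \<delta> by auto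
    fix q assume "q \<in> D1 \<inter> ({a - \<delta><..<a + \<delta>} \<times> {b - \<delta><..<b + \<delta>})"
    then obtain a' b' where q: "q = (a', b')" "a' \<in> {1/4<..<1/2}" "b' \<in> {1/2<..<3/4}"
      "\<bar>a' - a\<bar> < \<delta>" "\<bar>b' - b\<bar> < \<delta>"
      by (auto simp: D1_def)
    then show "H q = H (a, b)"
      using \<delta>(2)[of a' b'] by (simp add: H_def)
  qed
qed

text \<open>A neighbourhood witnessing local constancy at one point witnesses it at all of its
  points.\<close>

lemma openin_locally_constant_at: "openin (top_of_set D) {p \<in> D. locally_constant_at D g p}"
proof (subst openin_subopen, safe)
  fix p assume "locally_constant_at D g p"
  then obtain U where U: "openin (top_of_set D) U" "p \<in> U" "\<forall>q\<in>U. g q = g p"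
    by (auto simp: locally_constant_at_def)
  then have "locally_constant_at D g q" if "q \<in> U" for q
    using that unfolding locally_constant_at_def by (metis (no_types))
  then show "\<exists>T. openin (top_of_set D) T \<and> p \<in> T \<and> T \<subseteq> {p \<in> D. locally_constant_at D g p}"
    using U openin_imp_subset[OF U(1)] by (intro exI[of _ U]) auto
qed

subsection \<open>Null sets\<close>

text \<open>Self-similarity: the set misses one of the \<open>2 ^ j\<close> dyadic cells and is
  covered by copies of itself, scaled by \<open>1 / 2 ^ j\<close>, in the others. Its finite measure
  is thus at most \<open>1 - 1 / 2 ^ j\<close> times itself.\<close>

lemma null_sets_avoiding_dyadic:
  assumes "k < 2 ^ j"
  shows "{x \<in> circle. \<forall>n. frac (2 ^ n * x) \<notin> {real k / 2 ^ j..<(real k + 1) / 2 ^ j}}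
    \<in> null_sets lborel"
    (is "?A \<in> _")
proof -
  have meas: "?A \<in> sets borel"
    unfolding circle_def frac_def by measurable
  moreover have "bounded ?A"
    by (rule bounded_subset[OF bounded_closed_interval[of 0 1]]) (auto simp: circle_def)
  ultimately have fm: "?A \<in> lmeasurable"
    by (intro bounded_set_imp_lmeasurable) auto
  \<comment> \<open>\<open>T i\<close> is the inverse branch of \<open>j\<close> doublings with
    values in cell \<open>i\<close>.\<close>
  define T where "T i y = (1 / 2 ^ j) *\<^sub>R y + real i / 2 ^ j" for i and y :: real
  have fmT: "T i ` ?A \<in> lmeasurable" for i
  proof -
    have "T i ` ?A = (\<lambda>x. 2 ^ j * x - real i) -` ?A"
    proof (intro equalityI subsetI)
      fix x assume "x \<in> (\<lambda>x. 2 ^ j * x - real i) -` ?A"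
      moreover have "x = T i (2 ^ j * x - real i)"
        by (simp add: T_def field_simps)
      ultimately show "x \<in> T i ` ?A" by blast
    next
      fix x assume "x \<in> T i ` ?A"
      then obtain y where "y \<in> ?A" "x = T i y" by blast
      moreover have "2 ^ j * T i y - real i = y"
        by (simp add: T_def field_simps)
      ultimately show "x \<in> (\<lambda>x. 2 ^ j * x - real i) -` ?A" by simp
    qed
    moreover have "(\<lambda>x. 2 ^ j * x - real i) -` ?A \<in> sets borel"
      by (rule measurable_sets_borel[OF _ meas]) measurable
    moreover have "emeasure lebesgue (T i ` ?A) < \<infinity>"
      unfolding T_def emeasure_lebesgue_affine
      using fmeasurableD2[OF fm] by (auto simp: ennreal_mult_less_top less_top)
    ultimately show ?thesis
      by (intro fmeasurableI) auto
  qed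
  have cover: "?A \<subseteq> (\<Union>i\<in>{..<2 ^ j} - {k}. T i ` ?A)"
  proof
    fix x assume x: "x \<in> ?A"
    \<comment> \<open>The cell containing \<open>x\<close>; it differs from \<open>k\<close> because
      the orbit avoids cell \<open>k\<close> already at time 0.\<close>
    define i where "i = nat \<lfloor>2 ^ j * x\<rfloor>"
    have pos: "0 \<le> x" "x < 1" using x by (auto simp: circle_def)
    then have i: "real i = of_int \<lfloor>2 ^ j * x\<rfloor>"
      by (simp add: i_def)
    have "frac (2 ^ j * x) \<in> ?A"
      using x by (auto simp: circle_def frac_lt_1 frac_power2_comp)
    moreover have "x = T i (frac (2 ^ j * x))"
      by (simp add: T_def frac_def i field_simps)
    moreover have "2 ^ j * x < 2 ^ j * 1"
      using pos by (intro mult_strict_left_mono) auto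
    then have "real i < 2 ^ j"
      unfolding i by linarith
    then have "i < 2 ^ j"
      by (metis of_nat_less_iff of_nat_numeral of_nat_power)
    moreover have "i \<noteq> k"
    proof
      assume "i = k"
      then have "real k \<le> 2 ^ j * x" "2 ^ j * x < real k + 1"
        using i by linarith+
      then have "x \<in> {real k / 2 ^ j..<(real k + 1) / 2 ^ j}"
        by (simp add: field_simps)
      moreover have "frac (2 ^ 0 * x) = x"
        using pos by (simp add: frac_eq)
      ultimately show False
        using x by (metis (mono_tags, lifting) mem_Collect_eq)
    qed
    ultimately show "x \<in> (\<Union>i\<in>{..<2 ^ j} - {k}. T i ` ?A)"
      by blast
  qed
  define \<mu> where "\<mu> = measure lebesgue ?A"
  have "\<mu> \<le> measure lebesgue (\<Union>i\<in>{..<2 ^ j} - {k}. T i ` ?A)"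
    unfolding \<mu>_def using cover fm fmT
    by (intro measure_mono_fmeasurable fmeasurable.finite_UN fmeasurableD) auto
  also have "\<dots> \<le> (\<Sum>i\<in>{..<2 ^ j} - {k}. measure lebesgue (T i ` ?A))"
    using fmT by (intro measure_UNION_le fmeasurableD) auto
  also have "\<dots> = (\<Sum>i\<in>{..<2 ^ j} - {k}. \<mu> / 2 ^ j)"
    unfolding T_def by (subst measure_lebesgue_affine) (simp add: \<mu>_def)
  also have "\<dots> = (2 ^ j - 1) * (\<mu> / 2 ^ j)"
    using assms by (simp add: card_Diff_subset of_nat_diff)
  finally have "\<mu> \<le> 0"
    by (simp add: field_simps)
  moreover have "0 \<le> \<mu>"
    unfolding \<mu>_def by (rule measure_nonneg)
  ultimately have "\<mu> = 0" by simp
  then have "emeasure lebesgue ?A = 0"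
    by (simp only: \<mu>_def emeasure_eq_measure2[OF fm] ennreal_0)
  then show ?thesis
    using meas by (intro null_setsI) auto
qed

text \<open>One null set serves every \<open>b\<close>, which allows it to be used for both
  coordinates of the parameter plane.\<close>

lemma null_sets_avoiding_half:
  "\<exists>N\<in>null_sets lborel. \<forall>x\<in>circle - N. \<forall>b>1/2. \<exists>n. frac (2 ^ n * x) \<in> {1/2..<b}"
proof
  \<comment> \<open>These dyadic cells start at \<open>1/2\<close> and have length
    \<open>1 / 2 ^ Suc j\<close>, so some cell fits below any \<open>b > 1/2\<close>.\<close>
  let ?A = "\<lambda>j. {x \<in> circle. \<forall>n. frac (2 ^ n * x) \<notin> {real (2 ^ j) / 2 ^ Suc j..<(real (2 ^ j) + 1) / 2 ^ Suc j}}"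
  show "(\<Union>j. ?A j) \<in> null_sets lborel"
    by (intro null_sets_UN null_sets_avoiding_dyadic) simp
  show "\<forall>x\<in>circle - (\<Union>j. ?A j). \<forall>b>1/2. \<exists>n. frac (2 ^ n * x) \<in> {1/2..<b}"
  proof (intro ballI allI impI)
    fix x b :: real assume x: "x \<in> circle - (\<Union>j. ?A j)" and b: "b > 1/2"
    obtain j where j: "1 / (b - 1/2) < 2 ^ j"
      using real_arch_pow[of 2 "1 / (b - 1/2)"] by auto
    obtain n where n: "frac (2 ^ n * x) \<in> {real (2 ^ j) / 2 ^ Suc j..<(real (2 ^ j) + 1) / 2 ^ Suc j}"
      using x by blast
    have "(real (2 ^ j) + 1) / 2 ^ Suc j = 1/2 + 1 / 2 ^ j / 2"
      by (simp add: field_simps)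
    also have "1 / 2 ^ j < b - 1/2"
      using j b by (simp add: field_simps)
    also have "1/2 + (b - 1/2) / 2 < b"
      using b by (simp add: field_simps)
    finally have "(real (2 ^ j) + 1) / 2 ^ Suc j < b"
      by simp
    with n show "\<exists>n. frac (2 ^ n * x) \<in> {1/2..<b}"
      by (intro exI[of _ n]) auto
  qed
qed

lemma null_sets_lborel_Times:
  fixes A :: "'a :: euclidean_space set" and B :: "'b :: euclidean_space set"
  assumes "A \<in> sets lborel" "B \<in> sets lborel" "A \<in> null_sets lborel \<or> B \<in> null_sets lborel"
  shows "A \<times> B \<in> null_sets lborel"
proof -
  have "A \<times> B \<in> null_sets (lborel \<Otimes>\<^sub>M lborel)"
    using assms by (auto simp: null_sets_def lborel.emeasure_pair_measure_Times)
  then show ?thesis by (simp only: lborel_prod)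
qed

text \<open>When neither coordinate lies in \<open>N\<close>, both orbits enter
  \<open>{1/2..<b}\<close>, a part of the hole. The exceptional set is a subset of a null set, and
  completeness of \<open>lebesgue\<close> makes it measurable.\<close>

lemma H_locally_constant_ae: "D1 - {p \<in> D1. locally_constant_at D1 H p} \<in> null_sets lebesgue"
proof -
  obtain N where N: "N \<in> null_sets lborel"
    "\<And>x b. x \<in> circle - N \<Longrightarrow> b > 1/2 \<Longrightarrow> \<exists>n. frac (2 ^ n * x) \<in> {1/2..<b}"
    using null_sets_avoiding_half by blast
  have "N \<times> UNIV \<union> UNIV \<times> N \<in> null_sets lborel"
    using N(1) by (intro null_sets.Un null_sets_lborel_Times) auto
  moreover have "D1 - {p \<in> D1. locally_constant_at D1 H p} \<subseteq> N \<times> UNIV \<union> UNIV \<times> N"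
  proof (rule subsetI, rule ccontr)
    fix p assume p: "p \<in> D1 - {p \<in> D1. locally_constant_at D1 H p}"
      "p \<notin> N \<times> UNIV \<union> UNIV \<times> N"
    obtain a b where ab: "p = (a, b)" by fastforce
    have *: "a \<in> circle - N" "b \<in> circle - N" "a < 1/2" "1/2 < b"
      using p by (auto simp: ab D1_def circle_def)
    obtain n m where "frac (2 ^ n * a) \<in> {1/2..<b}" "frac (2 ^ m * b) \<in> {1/2..<b}"
      using N(2) * by meson
    then show False
      using locally_constant_at_H[of a b n m] * p by (auto simp: ab)
  qed
  ultimately show ?thesis
    by (meson null_sets_completionI null_sets_completion_subset)
qed

text \<open>The first conjunct expresses the codomain of \<open>H\<close>, whose type
  \<open>ereal\<close> also has infinite values.\<close>

theorem corollary3p4: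
  shows "H ` D1 \<subseteq> {0..1}
    \<and> openin (top_of_set D1) {p \<in> D1. locally_constant_at D1 H p}
    \<and> D1 \<subseteq> closure {p \<in> D1. locally_constant_at D1 H p}
    \<and> D1 - {p \<in> D1. locally_constant_at D1 H p} \<in> null_sets lebesgue"
proof (intro conjI)
  show "H ` D1 \<subseteq> {0..1}"
  proof (clarsimp simp: H_def)
    fix a b assume "(a, b) \<in> D1"
    then show "0 \<le> top_entropy circle_dist doubling (attractor a b) \<and>
        top_entropy circle_dist doubling (attractor a b) \<le> 1"
      by (intro conjI top_entropy_nonneg attractor_nonempty top_entropy_doubling_le_1)
         (auto simp: attractor_def avoiding_set_def)
  qed
  show "D1 \<subseteq> closure {p \<in> D1. locally_constant_at D1 H p}" (is "_ \<subseteq> closure ?G")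
  proof
    fix p assume p: "p \<in> D1"
    obtain a b where ab: "p = (a, b)" by fastforce
    have bounds: "a < 1/2" "1/2 < b" using p by (auto simp: ab D1_def)
    show "p \<in> closure ?G"
    proof (rule ccontr)
      assume "p \<notin> closure ?G"
      then have "open (- closure ?G)" "(a, b) \<in> - closure ?G"
        by (auto simp: ab)
      then obtain A B where AB: "open A" "open B" "a \<in> A" "b \<in> B" "A \<times> B \<subseteq> - closure ?G"
        by (rule open_prod_elim) auto
      \<comment> \<open>A rectangle with corner \<open>(a, b)\<close>, extending towards larger
        \<open>a\<close> and smaller \<open>b\<close>, the directions in which
        \<open>D1_mono\<close> stays inside \<open>D1\<close>.\<close>
      let ?W = "(A \<inter> {a<..<1/2}) \<times> (B \<inter> {1/2<..<b})"
      obtain e where e: "e > a" "{a..<e} \<subseteq> A"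
        using open_right[OF AB(1,3) bounds(1)] by blast
      obtain f where f: "f < b" "{f<..b} \<subseteq> B"
        using open_left[OF AB(2,4) bounds(2)] by blast
      obtain s t where "a < s" "s < min e (1/2)" "max f (1/2) < t" "t < b"
        using e f bounds dense[of a "min e (1/2)"] dense[of "max f (1/2)" b] by auto
      then have "(s, t) \<in> ?W" using e f by auto
      \<comment> \<open>A nonempty open set has positive measure, so \<open>?W\<close> cannot
        consist of exceptional points only.\<close>
      then have "\<not> negligible ?W"
        using AB by (intro open_not_negligible open_Times) auto
      then have "\<not> ?W \<subseteq> D1 - ?G"
        using H_locally_constant_ae negligible_subset by (auto simp: negligible_iff_null_sets)
      moreover have "?W \<subseteq> D1"
        using D1_mono p by (auto simp: ab)
      ultimately show False
        using AB(5) closure_subset[of ?G] by blast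
    qed
  qed
qed (rule openin_locally_constant_at H_locally_constant_ae)+

end
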